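(* For any positive integer $m$ and every complex $q$ with $0<|q|<1$, the following eight identities hold, where every sum is over integers $\alpha$ with $\left[\frac{1-m}{2}\right]\le\alpha\le\left[\frac{1+m}{2}\right]$: $$\varphi(-q^m)\varphi(q)=\sum_{\alpha}q^{\alpha^2}f\!\left(-q^{m(m+1+2\alpha)},-q^{m(m+1-2\alpha)}\right)f\!\left(-q^{m+1-2\alpha},-q^{m+1+2\alpha}\right),$$ $$\psi(-q^m)\psi(q)=\sum_{\alpha}q^{2\alpha^2+\alpha}f\!\left(-q^{2m(m+2\alpha+2)},-q^{2m(m-2\alpha)}\right)f\!\left(-q^{3m+1-4\alpha},-q^{m+3+4\alpha}\right),$$ $$f(-q^m)f(-q)=\sum_{\alpha}(-1)^\alpha q^{\alpha(3\alpha+1)/2}f_{m+1}\!\left(q^{m(3m+6\alpha+5)/2},q^{m(3m-6\alpha+1)/2}\right)f\!\left(q^{2m+1-3\alpha},q^{2+m+3\alpha}\right),$$ $$2\varphi(-q^m)\psi(q^2)=\sum_{\alpha}q^{\alpha^2+\alpha}f\!\left(-q^{m(m+2\alpha+2)},-q^{m(m-2\alpha)}\right)f\!\left(-q^{m-2\alpha},-q^{m+2\alpha+2}\right),$$ $$\varphi(-q^{2m})\psi(q)=\sum_{\alpha}q^{2\alpha^2+\alpha}f\!\left(-q^{m(2m+3+4\alpha)},-q^{m(2m+1-4\alpha)}\right)f\!\left(-q^{2m+1-4\alpha},-q^{2m+3+4\alpha}\right),$$ $$f(-q^{2m})\varphi(q^3)=\sum_{\alpha}q^{3\alpha^2}f\!\left(-q^{m(3m+6\alpha+4)},-q^{m(3m-6\alpha+2)}\right)f\!\left(-q^{4m+3-6\alpha},-q^{2m+3+6\alpha}\right),$$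 $$\psi(-q^m)\varphi(q^2)=\sum_{\alpha}q^{2\alpha^2}f\!\left(-q^{m(2m+3+4\alpha)},-q^{m(2m+1-4\alpha)}\right)f\!\left(-q^{3m+2-4\alpha},-q^{m+2+4\alpha}\right),$$ $$2\psi(-q^m)\psi(q^4)=\sum_{\alpha}q^{2\alpha^2+2\alpha}f\!\left(-q^{m(2m+4\alpha+5)},-q^{m(2m-4\alpha-1)}\right)f\!\left(-q^{3m-4\alpha},-q^{m+4+4\alpha}\right).$$
   Context: Ramanujan's general theta function is $f(a,b)=\sum_{n=-\infty}^{\infty}a^{n(n+1)/2}b^{n(n-1)/2}$ for $|ab|<1$. For an integer $\delta$, $f_\delta(a,b)=f(a,b)$ if $\delta$ is even and $f_\delta(a,b)=f(-a,-b)$ if $\delta$ is odd. For $|q|<1$: $\varphi(q)=f(q,q)=\sum_{n=-\infty}^\infty q^{n^2}$, $\psi(q)=f(q,q^3)=\sum_{n=0}^\infty q^{n(n+1)/2}$, and the one-variable function is $f(-q)=f(-q,-q^2)=\sum_{n=-\infty}^\infty(-1)^nq^{n(3n+1)/2}$ (so $f(-q^m)$ means $f(-q^m,-q^{2m})$). $[x]$ denotes the greatest integer less than or equal to $x$. *)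

theory Defs
  imports "HOL-Analysis.Analysis"
begin

text \<open>
  The exponents \<open>n (n + 1) / 2\<close> and \<open>n (n - 1) / 2\<close> are non-negative integers for
  every integer \<open>n\<close>, so \<open>div\<close> is exact. The series converges absolutely for
  \<open>\<bar>a b\<bar> < 1\<close>, where \<open>infsum\<close> is its ordinary sum; the function is meant to be used
  on that domain only.
\<close>

definition ramanujan_f :: "complex \<Rightarrow> complex \<Rightarrow> complex" where
  "ramanujan_f a b =
     (\<Sum>\<^sub>\<infinity>n::int. a powi (n * (n + 1) div 2) * b powi (n * (n - 1) div 2))"

definition ramanujan_f_par :: "int \<Rightarrow> complex \<Rightarrow> complex \<Rightarrow> complex" where
  "ramanujan_f_par \<delta> a b = (if even \<delta> then ramanujan_f a b else ramanujan_f (- a) (- b))"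

definition ramanujan_phi :: "complex \<Rightarrow> complex" where
  "ramanujan_phi q = ramanujan_f q q"

definition ramanujan_psi :: "complex \<Rightarrow> complex" where
  "ramanujan_psi q = ramanujan_f q (q ^ 3)"

text \<open>
  The one-variable function is customarily given by \<open>f(-q) = f(-q, -q\<^sup>2)\<close>; the
  argument \<open>x\<close> below stands for \<open>-q\<close>.
\<close>

definition ramanujan_f1 :: "complex \<Rightarrow> complex" where
  "ramanujan_f1 x = ramanujan_f x (- (x ^ 2))"

end

theory Submission
  imports Defs
begin

text \<open>
  Up to a sign, \<open>f(e q\<^sup>A, e q\<^sup>B)\<close> with \<open>e = \<plusminus>1\<close> is a sum of \<open>q\<close> to the power of a quadratic
  polynomial in \<open>n\<close> with leading coefficient \<open>(A + B) / 2\<close>. If \<open>A + B = m (C + D)\<close>, the product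
  of two such series has quadratic form proportional to \<open>m r\<^sup>2 + s\<^sup>2\<close>, and
  \<open>(m + 1) (m r\<^sup>2 + s\<^sup>2) = (m r + s)\<^sup>2 + m (s - r)\<^sup>2\<close>. Substituting \<open>r = l - n\<close>,
  \<open>s = l + m n + \<alpha>\<close>, with \<open>\<alpha>\<close> running through the residues modulo \<open>m + 1\<close>, therefore separates
  the variables \<open>l\<close> and \<open>n\<close>. All eight identities are instances, with the two containing
  a factor \<open>2\<close> resting on \<open>2 \<psi>(q) = f(q, 1)\<close>.
\<close>

section \<open>Theta functions as signed power series in \<open>q\<close>\<close>

definition theta_exp :: "int \<Rightarrow> int \<Rightarrow> int \<Rightarrow> int" where
  "theta_exp A B n = A * (n * (n + 1) div 2) + B * (n * (n - 1) div 2)"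

text \<open>Doubling removes both occurrences of \<open>div\<close>, so identities and bounds for
  exponents are reduced to polynomial ones.\<close>

lemma two_theta_exp: "2 * theta_exp A B n = (A + B) * n\<^sup>2 + (A - B) * n"
proof -
  have "2 * (n * (n + 1) div 2) = n * (n + 1)" "2 * (n * (n - 1) div 2) = n * (n - 1)"
    by simp_all
  hence "2 * theta_exp A B n = A * (n * (n + 1)) + B * (n * (n - 1))"
    unfolding theta_exp_def by (metis (no_types, lifting) distrib_left mult.left_commute)
  thus ?thesis by (simp add: algebra_simps power2_eq_square)
qed

lemma power_int_sign_even:
  fixes e :: complex
  assumes "e = 1 \<or> e = - 1" "even (k - n)"
  shows "e powi k = e powi n"
proof -
  from assms(2) obtain j where j: "k = n + 2 * j"
    by (metis add_diff_cancel_left' diff_add_cancel dvdE add.commute)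
  have "e \<noteq> 0" "e ^ 2 = 1" using assms(1) by auto
  thus ?thesis unfolding j by (simp add: power_int_add power_int_mult)
qed

text \<open>The two triangular exponents add up to the square of \<open>n\<close>, which has the
  parity of \<open>n\<close>; hence the signs collect to \<open>e powi n\<close>.\<close>

lemma ramanujan_f_term:
  fixes e q :: complex
  assumes "e = 1 \<or> e = - 1" "q \<noteq> 0"
  shows "(e * q powi A) powi (n * (n + 1) div 2) * (e * q powi B) powi (n * (n - 1) div 2)
         = e powi n * q powi theta_exp A B n"
proof -
  have e0: "e \<noteq> 0" using assms(1) by auto
  have "2 * (n * (n + 1) div 2) = n * (n + 1)" "2 * (n * (n - 1) div 2) = n * (n - 1)"
    by simp_all
  hence "n * (n + 1) div 2 + n * (n - 1) div 2 - n = n * (n - 1)"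
    unfolding right_diff_distrib distrib_left by linarith
  moreover have "even (n * (n - 1))" by simp
  ultimately have "e powi (n * (n + 1) div 2 + n * (n - 1) div 2) = e powi n"
    by (intro power_int_sign_even assms(1)) simp
  hence "e powi (n * (n + 1) div 2) * e powi (n * (n - 1) div 2) = e powi n"
    using e0 by (simp add: power_int_add)
  moreover have "q powi theta_exp A B n
      = (q powi A) powi (n * (n + 1) div 2) * (q powi B) powi (n * (n - 1) div 2)"
    using assms(2) by (simp add: theta_exp_def power_int_add power_int_mult)
  ultimately show ?thesis
    by (simp add: power_int_mult_distrib mult_ac)
qed

lemma ramanujan_f_sign:
  fixes e q :: complex
  assumes "e = 1 \<or> e = - 1" "q \<noteq> 0"
  shows "ramanujan_f (e * q powi A) (e * q powi B) = (\<Sum>\<^sub>\<infinity>n. e powi n * q powi theta_exp A B n)"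
  unfolding ramanujan_f_def ramanujan_f_term[OF assms] ..

lemma ramanujan_f_commute: "ramanujan_f a b = ramanujan_f b a"
  unfolding ramanujan_f_def
proof (rule infsum_reindex_bij_witness[of _ uminus uminus])
  fix n :: int
  have "(- n) * (- n + 1) = n * (n - 1)" "(- n) * (- n - 1) = n * (n + 1)"
    by (simp_all add: algebra_simps)
  thus "b powi (- n * (- n + 1) div 2) * a powi (- n * (- n - 1) div 2)
        = a powi (n * (n + 1) div 2) * b powi (n * (n - 1) div 2)"
    by (simp only: mult.commute)
qed auto

section \<open>Absolute convergence\<close>

lemma summable_on_power_abs_int:
  fixes r :: real
  assumes "0 \<le> r" "r < 1"
  shows "(\<lambda>n::int. r powi \<bar>n\<bar>) summable_on UNIV"
proof -
  have nat: "(\<lambda>n. r ^ n) summable_on (UNIV :: nat set)"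
    using assms by (simp add: summable_nonneg_imp_summable_on summable_geometric)
  have "(\<lambda>n::int. r powi \<bar>n\<bar>) summable_on range int"
    using nat by (subst summable_on_reindex) (auto simp: o_def)
  moreover have "(\<lambda>n::int. r powi \<bar>n\<bar>) summable_on range (\<lambda>n. - int n)"
    using nat by (subst summable_on_reindex) (auto simp: o_def inj_on_def)
  moreover have "range int \<union> range (\<lambda>n. - int n) = UNIV"
    by (metis (mono_tags, lifting) UNIV_eq_I UnCI int_cases2 rangeI)
  ultimately show ?thesis
    using summable_on_union by metis
qed

text \<open>A crude linear bound suffices to compare the theta series with a geometric series in
  \<open>\<bar>n\<bar>\<close>. It holds because the integer \<open>A + B\<close> is at least 1, so
  the quadratic term dominates.\<close>

lemma theta_exp_lower_bound:
  assumes "A + B > 0"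
  shows "\<bar>n\<bar> - (\<bar>A - B\<bar> + 2)\<^sup>2 \<le> theta_exp A B n"
proof -
  define v where "v = \<bar>A - B\<bar> + 2"
  have "n\<^sup>2 \<le> (A + B) * n\<^sup>2"
    using assms by (simp add: mult_le_cancel_right1)
  moreover have "- (\<bar>A - B\<bar> * \<bar>n\<bar>) \<le> (A - B) * n"
    by (metis abs_ge_minus_self abs_mult minus_le_iff)
  ultimately have "2 * theta_exp A B n \<ge> \<bar>n\<bar>\<^sup>2 - (v - 2) * \<bar>n\<bar>"
    unfolding two_theta_exp v_def by simp
  \<comment> \<open>The summand 2 in \<open>v\<close> makes the terms
    \<open>4 * \<bar>n\<bar>\<close> cancel, so that the difference is a sum of squares.\<close>
  moreover have "4 * \<bar>n\<bar> - 4 * v\<^sup>2 \<le> 2 * (\<bar>n\<bar>\<^sup>2 - (v - 2) * \<bar>n\<bar>)"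
  proof -
    have "2 * (\<bar>n\<bar>\<^sup>2 - (v - 2) * \<bar>n\<bar>) - (4 * \<bar>n\<bar> - 4 * v\<^sup>2)
        = (\<bar>n\<bar> - v)\<^sup>2 + \<bar>n\<bar>\<^sup>2 + 3 * v\<^sup>2"
      by (simp add: power2_eq_square algebra_simps)
    also have "\<dots> \<ge> 0" by simp
    finally show ?thesis by simp
  qed
  ultimately have "4 * (\<bar>n\<bar> - v\<^sup>2) \<le> 4 * theta_exp A B n"
    unfolding right_diff_distrib by linarith
  thus ?thesis unfolding v_def by simp
qed

lemma abs_summable_theta:
  fixes e q :: complex
  assumes "e = 1 \<or> e = - 1" "0 < norm q" "norm q < 1" "A + B > 0"
  shows "(\<lambda>n. norm (e powi n * q powi theta_exp A B n)) summable_on UNIV"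
proof (rule Infinite_Sum.abs_summable_on_comparison_test')
  let ?c = "(\<bar>A - B\<bar> + 2)\<^sup>2"
  show "(\<lambda>n. norm q powi (- ?c) * norm q powi \<bar>n\<bar>) summable_on (UNIV :: int set)"
    using assms by (intro summable_on_cmult_right summable_on_power_abs_int) auto
  fix n :: int
  have "norm e = 1" using assms(1) by auto
  hence "norm (e powi n * q powi theta_exp A B n) = norm q powi theta_exp A B n"
    by (simp add: norm_mult norm_power_int)
  also have "\<dots> \<le> norm q powi (- ?c + \<bar>n\<bar>)"
    using assms theta_exp_lower_bound[OF assms(4), of n] by (intro power_int_decreasing) auto
  also have "\<dots> = norm q powi (- ?c) * norm q powi \<bar>n\<bar>"
    using assms by (intro power_int_add) auto
  finally show "norm (e powi n * q powi theta_exp A B n)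
      \<le> norm q powi (- ?c) * norm q powi \<bar>n\<bar>" .
qed

section \<open>Products of series and the change of summation variables\<close>

lemma has_sum_product_abs:
  fixes f :: "'a \<Rightarrow> complex" and g :: "'b \<Rightarrow> complex"
  assumes "(\<lambda>x. norm (f x)) summable_on A" "(\<lambda>y. norm (g y)) summable_on B"
  shows "((\<lambda>(x, y). f x * g y) has_sum (infsum f A * infsum g B)) (A \<times> B)"
proof -
  \<comment> \<open>Absolute summability of the factors carries over to the family of products. This
    justifies Fubini below, where the iterated sum factors.\<close>
  have "(\<lambda>z. norm ((\<lambda>(x, y). f x * g y) z)) summable_on (A \<times> B)"
    using assms
    by (auto simp: Infinite_Sum.abs_summable_on_Sigma_iff norm_mult infsum_cmult_right' infsum_nonneg
             intro!: summable_on_cmult_right summable_on_cmult_left)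
  hence s: "(\<lambda>(x, y). f x * g y) summable_on (A \<times> B)"
    by (rule abs_summable_summable)
  have "infsum (\<lambda>(x, y). f x * g y) (A \<times> B) = (\<Sum>\<^sub>\<infinity>x\<in>A. \<Sum>\<^sub>\<infinity>y\<in>B. f x * g y)"
    using infsum_Sigma'_banach[OF s] by simp
  also have "\<dots> = infsum f A * infsum g B"
    by (simp add: infsum_cmult_right' infsum_cmult_left')
  finally show ?thesis using s by (metis has_sum_infsum)
qed

text \<open>
  From \<open>s - r = (m + 1) n + \<alpha>\<close>, the pair \<open>(n, \<alpha>)\<close> is the quotient and
  the shifted remainder of \<open>s - r\<close> modulo \<open>m + 1\<close>.
\<close>

lemma bij_betw_lattice_cosets:
  fixes m a :: int
  assumes "m \<ge> 0"
  shows "bij_betw (\<lambda>(\<alpha>, l, n). (l - n, l + m * n + \<alpha>)) ({a..a + m} \<times> UNIV \<times> UNIV) (UNIV \<times> UNIV)"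
proof (rule bij_betwI[where g = "\<lambda>(r, s). (a + (s - r - a) mod (m + 1),
      r + (s - r - a) div (m + 1), (s - r - a) div (m + 1))"])
  have "0 \<le> x mod (m + 1)" "x mod (m + 1) \<le> m" for x
    using assms pos_mod_bound[of "m + 1" x] by simp_all
  thus "(\<lambda>(r, s). (a + (s - r - a) mod (m + 1), r + (s - r - a) div (m + 1), (s - r - a) div (m + 1)))
      \<in> UNIV \<times> UNIV \<rightarrow> {a..a + m} \<times> UNIV \<times> UNIV"
    by auto
next
  fix x :: "int \<times> int \<times> int" assume "x \<in> {a..a + m} \<times> UNIV \<times> UNIV"
  then obtain \<alpha> l n where x: "x = (\<alpha>, l, n)" "a \<le> \<alpha>" "\<alpha> \<le> a + m" by auto
  have "l + m * n + \<alpha> - (l - n) - a = (\<alpha> - a) + (m + 1) * n" by (simp add: algebra_simps)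
  moreover have "((\<alpha> - a) + (m + 1) * n) div (m + 1) = n"
    "((\<alpha> - a) + (m + 1) * n) mod (m + 1) = \<alpha> - a"
    using x assms by (simp_all add: div_pos_pos_trivial mod_pos_pos_trivial)
  ultimately show "(\<lambda>(r, s). (a + (s - r - a) mod (m + 1), r + (s - r - a) div (m + 1), (s - r - a) div (m + 1)))
      ((\<lambda>(\<alpha>, l, n). (l - n, l + m * n + \<alpha>)) x) = x"
    by (simp only: x(1) prod.case) simp
next
  fix y :: "int \<times> int"
  obtain r s where y: "y = (r, s)" by force
  have "(m + 1) * ((s - r - a) div (m + 1)) + (s - r - a) mod (m + 1) = s - r - a"
    by (rule mult_div_mod_eq)
  thus "(\<lambda>(\<alpha>, l, n). (l - n, l + m * n + \<alpha>))
      ((\<lambda>(r, s). (a + (s - r - a) mod (m + 1), r + (s - r - a) div (m + 1), (s - r - a) div (m + 1))) y) = y"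
    by (simp add: y algebra_simps)
qed auto

text \<open>In the doubled exponents the cross term in \<open>l * n\<close> has coefficient
  \<open>2 * (m * (C + D) - (A + B))\<close>, which the hypothesis makes zero. What remains is a
  constant, a polynomial in \<open>l\<close> and a polynomial in \<open>n\<close>, each again of the
  form \<open>theta_exp\<close>.\<close>

lemma theta_exp_split:
  assumes "A + B = m * (C + D)"
  shows "theta_exp A B (l - n) + theta_exp C D (l + m * n + \<alpha>)
       = theta_exp C D \<alpha>
         + theta_exp ((C + D) * \<alpha> + A + C) (B + D - (C + D) * \<alpha>) l
         + theta_exp ((C + D) * (m * \<alpha> + m * (m - 1) div 2) + m * C + B)
                     ((C + D) * (m * (m - 1) div 2 - m * \<alpha>) + m * D + A) n"
proof -
  \<comment> \<open>Naming the quotient hides \<open>div\<close>; the identity then follows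
    algebraically from \<open>2 * k = m * m - m\<close> alone.\<close>
  define k where "k = m * (m - 1) div 2"
  have k: "2 * k = m * m - m" by (simp add: k_def algebra_simps)
  have B: "B = m * (C + D) - A" using assms by simp
  have "2 * (theta_exp A B (l - n) + theta_exp C D (l + m * n + \<alpha>))
      = 2 * (theta_exp C D \<alpha>
         + theta_exp ((C + D) * \<alpha> + A + C) (B + D - (C + D) * \<alpha>) l
         + theta_exp ((C + D) * (m * \<alpha> + k) + m * C + B)
                     ((C + D) * (k - m * \<alpha>) + m * D + A) n)"
    unfolding distrib_left two_theta_exp B power2_eq_square using k by algebra
  thus ?thesis unfolding k_def by (metis mult_cancel_left zero_neq_numeral)
qed

text \<open>The double series over \<open>(r, s)\<close> is regrouped by the class \<alpha> of
  \<open>s - r\<close> modulo \<open>m + 1\<close>; any \<open>m + 1\<close> consecutive integers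
  may represent the classes, hence the free \<open>a\<close>. For each \<alpha> the sum over
  \<open>n\<close> gives the first theta factor and the sum over \<open>l\<close> the
  second.\<close>

theorem ramanujan_f_product:
  fixes m a A B C D :: int and e1 e2 q :: complex
  assumes m: "m > 0" and q: "0 < norm q" "norm q < 1"
    and e1: "e1 = 1 \<or> e1 = - 1" and e2: "e2 = 1 \<or> e2 = - 1"
    and AB: "A + B = m * (C + D)" and CD: "C + D > 0"
  shows "ramanujan_f (e1 * q powi A) (e1 * q powi B) * ramanujan_f (e2 * q powi C) (e2 * q powi D)
    = (\<Sum>\<alpha>\<in>{a..a + m}. e2 powi \<alpha> * q powi theta_exp C D \<alpha>
        * ramanujan_f (e1 * e2 powi m * q powi ((C + D) * (m * \<alpha> + m * (m - 1) div 2) + m * C + B))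
                      (e1 * e2 powi m * q powi ((C + D) * (m * (m - 1) div 2 - m * \<alpha>) + m * D + A))
        * ramanujan_f (e1 * e2 * q powi (B + D - (C + D) * \<alpha>))
                      (e1 * e2 * q powi ((C + D) * \<alpha> + A + C)))"
    (is "_ = (\<Sum>\<alpha>\<in>_. ?c \<alpha> * ramanujan_f (_ * q powi ?R \<alpha>) (_ * q powi ?S \<alpha>)
                * ramanujan_f (_ * q powi ?Q \<alpha>) (_ * q powi ?P \<alpha>))")
proof -
  define F where "F = (\<lambda>r. e1 powi r * q powi theta_exp A B r)"
  define G where "G = (\<lambda>s. e2 powi s * q powi theta_exp C D s)"
  define H where "H = (\<lambda>\<alpha> n. (e1 * e2 powi m) powi n * q powi theta_exp (?R \<alpha>) (?S \<alpha>) n)"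
  define K where "K = (\<lambda>\<alpha> l. (e1 * e2) powi l * q powi theta_exp (?P \<alpha>) (?Q \<alpha>) l)"
  have q0: "q \<noteq> 0" and e0: "e1 \<noteq> 0" "e2 \<noteq> 0" using q e1 e2 by auto
  have e12: "e1 * e2 = 1 \<or> e1 * e2 = - 1" using e1 e2 by auto
  have e2m: "e2 powi m = 1 \<or> e2 powi m = - 1"
    using e2 by (cases "even m") (auto simp: power_int_minus_left)
  hence em: "e1 * e2 powi m = 1 \<or> e1 * e2 powi m = - 1" using e1 by auto
  have AB0: "A + B > 0" using AB CD m by simp
  have F: "(\<lambda>r. norm (F r)) summable_on UNIV" and G: "(\<lambda>s. norm (G s)) summable_on UNIV"
    unfolding F_def G_def using abs_summable_theta e1 e2 q AB0 CD by blast+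
  have H: "(\<lambda>n. norm (H \<alpha> n)) summable_on UNIV" for \<alpha>
  proof -
    \<comment> \<open>The terms in \<alpha> cancel in the sum of the two exponents, so convergence
      is uniform in the choice of class representative.\<close>
    have "?R \<alpha> + ?S \<alpha> = (C + D) * (2 * (m * (m - 1) div 2)) + m * (C + D) + (A + B)"
      by (simp add: algebra_simps)
    also have "\<dots> > 0"
    proof -
      have "0 \<le> (C + D) * (2 * (m * (m - 1) div 2))" "0 \<le> m * (C + D)"
        using CD m by (intro mult_nonneg_nonneg; simp)+
      thus ?thesis using AB0 by linarith
    qed
    finally show ?thesis unfolding H_def by (intro abs_summable_theta em q)
  qed
  have K: "(\<lambda>l. norm (K \<alpha> l)) summable_on UNIV" for \<alpha>
  proof -
    have "?P \<alpha> + ?Q \<alpha> > 0" using AB0 CD by simp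
    thus ?thesis unfolding K_def by (intro abs_summable_theta e12 q)
  qed
  have split: "F (l - n) * G (l + m * n + \<alpha>) = ?c \<alpha> * (K \<alpha> l * H \<alpha> n)" for l n \<alpha>
  proof -
    \<comment> \<open>Replacing \<open>l - n\<close> by \<open>l + n\<close> costs no sign and lets
      the powers of \<open>e1\<close> and \<open>e2\<close> separate into a sign in \<open>l\<close>
      and a sign in \<open>n\<close>.\<close>
    have "e1 powi (l - n) = e1 powi (l + n)"
      by (rule power_int_sign_even[OF e1]) simp
    hence signs: "e1 powi (l - n) * e2 powi (l + m * n + \<alpha>)
        = e2 powi \<alpha> * (e1 * e2) powi l * (e1 * e2 powi m) powi n"
      using e0 by (simp add: power_int_add power_int_mult_distrib power_int_mult mult_ac)
    have powers: "q powi theta_exp A B (l - n) * q powi theta_exp C D (l + m * n + \<alpha>)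
        = q powi theta_exp C D \<alpha> * q powi theta_exp (?P \<alpha>) (?Q \<alpha>) l * q powi theta_exp (?R \<alpha>) (?S \<alpha>) n"
      using q0 unfolding power_int_add[OF disjI1, OF q0, symmetric] theta_exp_split[OF AB] by simp
    have "F (l - n) * G (l + m * n + \<alpha>)
        = (e1 powi (l - n) * e2 powi (l + m * n + \<alpha>))
          * (q powi theta_exp A B (l - n) * q powi theta_exp C D (l + m * n + \<alpha>))"
      unfolding F_def G_def by (simp only: mult_ac)
    thus ?thesis unfolding signs powers H_def K_def by (simp only: mult_ac)
  qed
  have "((\<lambda>(r, s). F r * G s) has_sum (infsum F UNIV * infsum G UNIV)) (UNIV \<times> UNIV)"
    by (rule has_sum_product_abs[OF F G])
  hence "((\<lambda>x. (\<lambda>(r, s). F r * G s) ((\<lambda>(\<alpha>, l, n). (l - n, l + m * n + \<alpha>)) x))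
      has_sum (infsum F UNIV * infsum G UNIV)) ({a..a + m} \<times> UNIV \<times> UNIV)"
    using m by (subst has_sum_reindex_bij_betw[OF bij_betw_lattice_cosets]) auto
  hence total: "((\<lambda>(\<alpha>, y). ?c \<alpha> * (\<lambda>(l, n). K \<alpha> l * H \<alpha> n) y)
      has_sum (infsum F UNIV * infsum G UNIV)) ({a..a + m} \<times> UNIV \<times> UNIV)"
    by (simp add: case_prod_unfold split)
  have inner: "((\<lambda>y. ?c \<alpha> * (\<lambda>(l, n). K \<alpha> l * H \<alpha> n) y)
      has_sum (?c \<alpha> * (infsum (K \<alpha>) UNIV * infsum (H \<alpha>) UNIV))) (UNIV \<times> UNIV)" for \<alpha>
    by (intro has_sum_cmult_right has_sum_product_abs K H)
  \<comment> \<open>Summing over \<open>(l, n)\<close> first leaves a sum over the finite set of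
    classes.\<close>
  have "((\<lambda>\<alpha>. ?c \<alpha> * (infsum (K \<alpha>) UNIV * infsum (H \<alpha>) UNIV))
      has_sum (infsum F UNIV * infsum G UNIV)) {a..a + m}"
    by (rule has_sum_SigmaD[OF total]) (unfold prod.case, rule inner[unfolded prod.case])
  hence "infsum F UNIV * infsum G UNIV
      = (\<Sum>\<alpha>\<in>{a..a + m}. ?c \<alpha> * (infsum (K \<alpha>) UNIV * infsum (H \<alpha>) UNIV))"
    by (simp add: has_sum_finite_iff)
  moreover have "infsum F UNIV = ramanujan_f (e1 * q powi A) (e1 * q powi B)"
    "infsum G UNIV = ramanujan_f (e2 * q powi C) (e2 * q powi D)"
    unfolding F_def G_def ramanujan_f_sign[OF e1 q0] ramanujan_f_sign[OF e2 q0] by simp_all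
  moreover have "infsum (H \<alpha>) UNIV
      = ramanujan_f (e1 * e2 powi m * q powi ?R \<alpha>) (e1 * e2 powi m * q powi ?S \<alpha>)" for \<alpha>
    unfolding H_def ramanujan_f_sign[OF em q0] ..
  \<comment> \<open>The symmetry of \<open>ramanujan_f\<close> puts the arguments into the order of
    the stated identities.\<close>
  moreover have "infsum (K \<alpha>) UNIV
      = ramanujan_f (e1 * e2 * q powi ?Q \<alpha>) (e1 * e2 * q powi ?P \<alpha>)" for \<alpha>
    unfolding K_def ramanujan_f_sign[OF e12 q0, symmetric] by (rule ramanujan_f_commute)
  ultimately show ?thesis
    by (simp only: mult_ac)
qed

section \<open>The doubled series of \<psi>\<close>

lemma ramanujan_f_one_right:
  fixes q :: complex
  assumes "0 < norm q" "norm q < 1" "k > 0"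
  shows "ramanujan_f (q powi k) 1 = 2 * ramanujan_psi (q powi k)"
proof -
  define T where "T = (\<lambda>n. q powi theta_exp k 0 n)"
  have q0: "q \<noteq> 0" using assms by auto
  have f: "ramanujan_f (q powi A) (q powi B) = (\<Sum>\<^sub>\<infinity>n. q powi theta_exp A B n)" for A B
    using ramanujan_f_sign[of 1, OF _ q0] by simp
  have T: "T summable_on UNIV"
    using abs_summable_summable[OF abs_summable_theta[of 1 q k 0]] assms by (simp add: T_def)
  have psi: "ramanujan_psi (q powi k) = (\<Sum>\<^sub>\<infinity>n. q powi theta_exp k (3 * k) n)"
    unfolding ramanujan_psi_def f[symmetric] by (simp add: power_int_mult mult.commute)
  \<comment> \<open>Each triangular number belongs to exactly one even and one odd index. The even
    half reproduces the series of \<psi> after the reflection of \<open>n\<close>, the odd half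
    without it.\<close>
  have even: "T (2 * n) = q powi theta_exp k (3 * k) (- n)" for n
  proof -
    have "2 * theta_exp k 0 (2 * n) = 2 * theta_exp k (3 * k) (- n)"
      unfolding two_theta_exp by (simp add: power2_eq_square algebra_simps)
    thus ?thesis by (simp add: T_def)
  qed
  have odd: "T (2 * n - 1) = q powi theta_exp k (3 * k) n" for n
  proof -
    have "2 * theta_exp k 0 (2 * n - 1) = 2 * theta_exp k (3 * k) n"
      unfolding two_theta_exp by (simp add: power2_eq_square algebra_simps)
    thus ?thesis by (simp add: T_def)
  qed
  have "infsum T {n. even n} = ramanujan_psi (q powi k)"
    unfolding psi
    by (rule infsum_reindex_bij_witness[of _ "\<lambda>n. - 2 * n" "\<lambda>n. - (n div 2)"])
       (auto simp flip: even)
  moreover have "infsum T {n. odd n} = ramanujan_psi (q powi k)"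
    unfolding psi
    by (rule infsum_reindex_bij_witness[of _ "\<lambda>n. 2 * n - 1" "\<lambda>n. (n + 1) div 2"])
       (auto simp: odd[symmetric] add.commute[of 1] elim!: oddE)
  moreover have "infsum T ({n. even n} \<union> {n. odd n}) = infsum T {n. even n} + infsum T {n. odd n}"
    using T by (intro infsum_Un_disjoint) (auto intro: summable_on_subset_banach)
  moreover have "{n. even n} \<union> {n. odd n} = (UNIV :: int set)" by auto
  \<comment> \<open>The argument 1 is \<open>q powi 0\<close>, so \<open>f\<close> applies with
    exponents \<open>k\<close> and 0.\<close>
  ultimately show ?thesis
    using f[of k 0] by (simp add: T_def)
qed

section \<open>The product formula in a form ready for specialisation\<close>

lemma floor_half_range:
  "\<lfloor>(1 + real_of_int m) / 2\<rfloor> = \<lfloor>(1 - real_of_int m) / 2\<rfloor> + m"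
proof -
  have "(1 + real_of_int m) / 2 = (1 - real_of_int m) / 2 + of_int m" by (simp add: field_simps)
  thus ?thesis by (metis floor_add_int)
qed

text \<open>The exponents and signs are variables here, so the rule unifies with an identity as
  displayed and leaves polynomial equations to check. Those for \<open>t\<close>, \<open>R\<close>
  and \<open>S\<close> are doubled to avoid \<open>div\<close>.\<close>

lemma ramanujan_f_product_eq:
  fixes m A B C D :: int and e1 e2 e3 e4 q :: complex and t P Q R S :: "int \<Rightarrow> int"
  assumes "m > 0" "0 < norm q" "norm q < 1" "e1 = 1 \<or> e1 = - 1" "e2 = 1 \<or> e2 = - 1"
    and "A + B = m * (C + D)" "C + D > 0"
    and e3: "e3 = e1 * e2 powi m" and e4: "e4 = e1 * e2"
    and t: "\<And>\<alpha>. 2 * t \<alpha> = (C + D) * \<alpha>\<^sup>2 + (C - D) * \<alpha>"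
    and R: "\<And>\<alpha>. 2 * R \<alpha> = (C + D) * (2 * m * \<alpha> + m\<^sup>2 - m) + 2 * m * C + 2 * B"
    and S: "\<And>\<alpha>. 2 * S \<alpha> = (C + D) * (m\<^sup>2 - m - 2 * m * \<alpha>) + 2 * m * D + 2 * A"
    and Q: "\<And>\<alpha>. Q \<alpha> = B + D - (C + D) * \<alpha>"
    and P: "\<And>\<alpha>. P \<alpha> = (C + D) * \<alpha> + A + C"
  shows "ramanujan_f (e1 * q powi A) (e1 * q powi B) * ramanujan_f (e2 * q powi C) (e2 * q powi D)
    = (\<Sum>\<alpha>\<in>{\<lfloor>(1 - real_of_int m) / 2\<rfloor>..\<lfloor>(1 + real_of_int m) / 2\<rfloor>}. e2 powi \<alpha> * q powi t \<alpha>
        * ramanujan_f (e3 * q powi R \<alpha>) (e3 * q powi S \<alpha>)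
        * ramanujan_f (e4 * q powi Q \<alpha>) (e4 * q powi P \<alpha>))"
proof -
  define k where "k = m * (m - 1) div 2"
  have k: "2 * k = m\<^sup>2 - m" by (simp add: k_def power2_eq_square algebra_simps)
  have t': "theta_exp C D \<alpha> = t \<alpha>" for \<alpha>
    using t[of \<alpha>] two_theta_exp[of C D \<alpha>] by simp
  have "2 * ((C + D) * (m * \<alpha> + k) + m * C + B) = 2 * R \<alpha>"
    "2 * ((C + D) * (k - m * \<alpha>) + m * D + A) = 2 * S \<alpha>" for \<alpha>
    unfolding R S using k by algebra+
  hence R': "(C + D) * (m * \<alpha> + k) + m * C + B = R \<alpha>"
    and S': "(C + D) * (k - m * \<alpha>) + m * D + A = S \<alpha>" for \<alpha>
    by (metis mult_cancel_left zero_neq_numeral)+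
  \<comment> \<open>By \<open>floor_half_range\<close> the interval has the form
    \<open>{a..a + m}\<close>, a complete residue system modulo \<open>m + 1\<close>.\<close>
  show ?thesis
    using ramanujan_f_product[OF assms(1-7)]
    unfolding k_def[symmetric] R' S' t' P[symmetric] Q[symmetric] e3[symmetric] e4[symmetric]
      floor_half_range by simp
qed

section \<open>The eight identities\<close>

theorem corollary4p0p1:
  fixes m :: int and q :: complex
  assumes "m > 0" and "0 < norm q" and "norm q < 1"
  shows "(ramanujan_phi (- (q powi m)) * ramanujan_phi q =
        (\<Sum>\<alpha>\<in>{\<lfloor>(1 - real_of_int m) / 2\<rfloor>..\<lfloor>(1 + real_of_int m) / 2\<rfloor>}.
           q powi (\<alpha>^2)
           * ramanujan_f (- (q powi (m * (m + 1 + 2 * \<alpha>)))) (- (q powi (m * (m + 1 - 2 * \<alpha>))))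
           * ramanujan_f (- (q powi (m + 1 - 2 * \<alpha>))) (- (q powi (m + 1 + 2 * \<alpha>)))))
     \<and> (ramanujan_psi (- (q powi m)) * ramanujan_psi q =
        (\<Sum>\<alpha>\<in>{\<lfloor>(1 - real_of_int m) / 2\<rfloor>..\<lfloor>(1 + real_of_int m) / 2\<rfloor>}.
           q powi (2 * \<alpha>^2 + \<alpha>)
           * ramanujan_f (- (q powi (2 * m * (m + 2 * \<alpha> + 2)))) (- (q powi (2 * m * (m - 2 * \<alpha>))))
           * ramanujan_f (- (q powi (3 * m + 1 - 4 * \<alpha>))) (- (q powi (m + 3 + 4 * \<alpha>)))))
     \<and> (ramanujan_f1 (- (q powi m)) * ramanujan_f1 (- q) =
        (\<Sum>\<alpha>\<in>{\<lfloor>(1 - real_of_int m) / 2\<rfloor>..\<lfloor>(1 + real_of_int m) / 2\<rfloor>}.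
           (- 1) powi \<alpha> * q powi (\<alpha> * (3 * \<alpha> + 1) div 2)
           * ramanujan_f_par (m + 1) (q powi (m * (3 * m + 6 * \<alpha> + 5) div 2)) (q powi (m * (3 * m - 6 * \<alpha> + 1) div 2))
           * ramanujan_f (q powi (2 * m + 1 - 3 * \<alpha>)) (q powi (2 + m + 3 * \<alpha>))))
     \<and> (2 * ramanujan_phi (- (q powi m)) * ramanujan_psi (q ^ 2) =
        (\<Sum>\<alpha>\<in>{\<lfloor>(1 - real_of_int m) / 2\<rfloor>..\<lfloor>(1 + real_of_int m) / 2\<rfloor>}.
           q powi (\<alpha>^2 + \<alpha>)
           * ramanujan_f (- (q powi (m * (m + 2 * \<alpha> + 2)))) (- (q powi (m * (m - 2 * \<alpha>))))
           * ramanujan_f (- (q powi (m - 2 * \<alpha>))) (- (q powi (m + 2 * \<alpha> + 2)))))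
     \<and> (ramanujan_phi (- (q powi (2 * m))) * ramanujan_psi q =
        (\<Sum>\<alpha>\<in>{\<lfloor>(1 - real_of_int m) / 2\<rfloor>..\<lfloor>(1 + real_of_int m) / 2\<rfloor>}.
           q powi (2 * \<alpha>^2 + \<alpha>)
           * ramanujan_f (- (q powi (m * (2 * m + 3 + 4 * \<alpha>)))) (- (q powi (m * (2 * m + 1 - 4 * \<alpha>))))
           * ramanujan_f (- (q powi (2 * m + 1 - 4 * \<alpha>))) (- (q powi (2 * m + 3 + 4 * \<alpha>)))))
     \<and> (ramanujan_f1 (- (q powi (2 * m))) * ramanujan_phi (q ^ 3) =
        (\<Sum>\<alpha>\<in>{\<lfloor>(1 - real_of_int m) / 2\<rfloor>..\<lfloor>(1 + real_of_int m) / 2\<rfloor>}.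
           q powi (3 * \<alpha>^2)
           * ramanujan_f (- (q powi (m * (3 * m + 6 * \<alpha> + 4)))) (- (q powi (m * (3 * m - 6 * \<alpha> + 2))))
           * ramanujan_f (- (q powi (4 * m + 3 - 6 * \<alpha>))) (- (q powi (2 * m + 3 + 6 * \<alpha>)))))
     \<and> (ramanujan_psi (- (q powi m)) * ramanujan_phi (q ^ 2) =
        (\<Sum>\<alpha>\<in>{\<lfloor>(1 - real_of_int m) / 2\<rfloor>..\<lfloor>(1 + real_of_int m) / 2\<rfloor>}.
           q powi (2 * \<alpha>^2)
           * ramanujan_f (- (q powi (m * (2 * m + 3 + 4 * \<alpha>)))) (- (q powi (m * (2 * m + 1 - 4 * \<alpha>))))
           * ramanujan_f (- (q powi (3 * m + 2 - 4 * \<alpha>))) (- (q powi (m + 2 + 4 * \<alpha>)))))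
     \<and> (2 * ramanujan_psi (- (q powi m)) * ramanujan_psi (q ^ 4) =
        (\<Sum>\<alpha>\<in>{\<lfloor>(1 - real_of_int m) / 2\<rfloor>..\<lfloor>(1 + real_of_int m) / 2\<rfloor>}.
           q powi (2 * \<alpha>^2 + 2 * \<alpha>)
           * ramanujan_f (- (q powi (m * (2 * m + 4 * \<alpha> + 5)))) (- (q powi (m * (2 * m - 4 * \<alpha> - 1))))
           * ramanujan_f (- (q powi (3 * m - 4 * \<alpha>))) (- (q powi (m + 4 + 4 * \<alpha>)))))"
proof -
  let ?I = "{\<lfloor>(1 - real_of_int m) / 2\<rfloor>..\<lfloor>(1 + real_of_int m) / 2\<rfloor>}"
  note product = ramanujan_f_product_eq[OF assms]
  have psi: "ramanujan_psi (- (q powi k)) = ramanujan_f ((- 1) * q powi k) ((- 1) * q powi (3 * k))" for k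
    by (simp add: ramanujan_psi_def power_int_mult mult.commute[of 3])
  have f1: "ramanujan_f1 (- (q powi k)) = ramanujan_f ((- 1) * q powi k) ((- 1) * q powi (2 * k))" for k
    by (simp add: ramanujan_f1_def power_int_mult mult.commute[of 2])
  have phi: "ramanujan_phi (- (q powi k)) = ramanujan_f ((- 1) * q powi k) ((- 1) * q powi k)" for k
    by (simp add: ramanujan_phi_def)
  \<comment> \<open>The exponent 3 comes first, so that \<open>C - D = 2\<close> yields the power
    \<open>2 * \<alpha>^2 + \<alpha>\<close> and not
    \<open>2 * \<alpha>^2 - \<alpha>\<close>.\<close>
  have psi_q: "ramanujan_psi q = ramanujan_f (1 * q powi 3) (1 * q powi 1)"
    by (simp add: ramanujan_psi_def ramanujan_f_commute)
  have two_psi: "2 * ramanujan_psi (q ^ 2) = ramanujan_f (1 * q powi 2) (1 * q powi 0)"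
    "2 * ramanujan_psi (q ^ 4) = ramanujan_f (1 * q powi 4) (1 * q powi 0)"
    using ramanujan_f_one_right[of q 2] ramanujan_f_one_right[of q 4] assms by simp_all

  \<comment> \<open>Every identity takes \<open>e1 = - 1\<close>, and all but the third take
    \<open>e2 = 1\<close>; explicit factors \<open>1\<close> and \<open>- 1\<close> let the rule
    match. Here \<open>A = B = m\<close> and \<open>C = D = 1\<close>.\<close>
  have 1: "ramanujan_phi (- (q powi m)) * ramanujan_phi q =
        (\<Sum>\<alpha>\<in>?I. 1 powi \<alpha> * q powi (\<alpha>^2)
           * ramanujan_f ((- 1) * q powi (m * (m + 1 + 2 * \<alpha>))) ((- 1) * q powi (m * (m + 1 - 2 * \<alpha>)))
           * ramanujan_f ((- 1) * q powi (m + 1 - 2 * \<alpha>)) ((- 1) * q powi (m + 1 + 2 * \<alpha>)))"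
  proof -
    have "ramanujan_phi q = ramanujan_f (1 * q powi 1) (1 * q powi 1)"
      by (simp add: ramanujan_phi_def)
    thus ?thesis unfolding phi
      by (simp only:) (rule product, auto simp: power2_eq_square algebra_simps)
  qed
  \<comment> \<open>\<open>(A, B, C, D) = (m, 3 * m, 3, 1)\<close>.\<close>
  have 2: "ramanujan_psi (- (q powi m)) * ramanujan_psi q =
        (\<Sum>\<alpha>\<in>?I. 1 powi \<alpha> * q powi (2 * \<alpha>^2 + \<alpha>)
           * ramanujan_f ((- 1) * q powi (2 * m * (m + 2 * \<alpha> + 2))) ((- 1) * q powi (2 * m * (m - 2 * \<alpha>)))
           * ramanujan_f ((- 1) * q powi (3 * m + 1 - 4 * \<alpha>)) ((- 1) * q powi (m + 3 + 4 * \<alpha>)))"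
    unfolding psi psi_q by (rule product) (auto simp: power2_eq_square algebra_simps)
  \<comment> \<open>\<open>(A, B, C, D) = (m, 2 * m, 2, 1)\<close> with \<open>e2 = - 1\<close>: the
    first theta factor gets the sign \<open>(- 1) powi (m + 1)\<close>, the second the sign
    1.\<close>
  have 3: "ramanujan_f1 (- (q powi m)) * ramanujan_f1 (- q) =
        (\<Sum>\<alpha>\<in>?I. (- 1) powi \<alpha> * q powi (\<alpha> * (3 * \<alpha> + 1) div 2)
           * ramanujan_f ((- 1) powi (m + 1) * q powi (m * (3 * m + 6 * \<alpha> + 5) div 2))
                         ((- 1) powi (m + 1) * q powi (m * (3 * m - 6 * \<alpha> + 1) div 2))
           * ramanujan_f (1 * q powi (2 * m + 1 - 3 * \<alpha>)) (1 * q powi (2 + m + 3 * \<alpha>)))"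
  proof -
    have "ramanujan_f1 (- q) = ramanujan_f ((- 1) * q powi 2) ((- 1) * q powi 1)"
      by (simp add: ramanujan_f1_def ramanujan_f_commute)
    thus ?thesis unfolding f1
      by (simp only:)
         (rule product, simp_all add: power2_eq_square power_int_add algebra_simps)
  qed
  \<comment> \<open>\<open>(A, B, C, D) = (m, m, 2, 0)\<close>; \<open>D = 0\<close> brings in the
    factor 2.\<close>
  have 4: "ramanujan_phi (- (q powi m)) * (2 * ramanujan_psi (q ^ 2)) =
        (\<Sum>\<alpha>\<in>?I. 1 powi \<alpha> * q powi (\<alpha>^2 + \<alpha>)
           * ramanujan_f ((- 1) * q powi (m * (m + 2 * \<alpha> + 2))) ((- 1) * q powi (m * (m - 2 * \<alpha>)))
           * ramanujan_f ((- 1) * q powi (m - 2 * \<alpha>)) ((- 1) * q powi (m + 2 * \<alpha> + 2)))"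
    unfolding phi two_psi by (rule product) (auto simp: power2_eq_square algebra_simps)
  \<comment> \<open>\<open>(A, B, C, D) = (2 * m, 2 * m, 3, 1)\<close>.\<close>
  have 5: "ramanujan_phi (- (q powi (2 * m))) * ramanujan_psi q =
        (\<Sum>\<alpha>\<in>?I. 1 powi \<alpha> * q powi (2 * \<alpha>^2 + \<alpha>)
           * ramanujan_f ((- 1) * q powi (m * (2 * m + 3 + 4 * \<alpha>))) ((- 1) * q powi (m * (2 * m + 1 - 4 * \<alpha>)))
           * ramanujan_f ((- 1) * q powi (2 * m + 1 - 4 * \<alpha>)) ((- 1) * q powi (2 * m + 3 + 4 * \<alpha>)))"
    unfolding phi psi_q by (rule product) (auto simp: power2_eq_square algebra_simps)
  \<comment> \<open>\<open>(A, B, C, D) = (2 * m, 4 * m, 3, 3)\<close>.\<close>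
  have 6: "ramanujan_f1 (- (q powi (2 * m))) * ramanujan_phi (q ^ 3) =
        (\<Sum>\<alpha>\<in>?I. 1 powi \<alpha> * q powi (3 * \<alpha>^2)
           * ramanujan_f ((- 1) * q powi (m * (3 * m + 6 * \<alpha> + 4))) ((- 1) * q powi (m * (3 * m - 6 * \<alpha> + 2)))
           * ramanujan_f ((- 1) * q powi (4 * m + 3 - 6 * \<alpha>)) ((- 1) * q powi (2 * m + 3 + 6 * \<alpha>)))"
  proof -
    have "ramanujan_phi (q ^ 3) = ramanujan_f (1 * q powi 3) (1 * q powi 3)"
      by (simp add: ramanujan_phi_def)
    thus ?thesis unfolding f1
      by (simp only:) (rule product, auto simp: power2_eq_square algebra_simps)
  qed
  \<comment> \<open>\<open>(A, B, C, D) = (m, 3 * m, 2, 2)\<close>.\<close>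
  have 7: "ramanujan_psi (- (q powi m)) * ramanujan_phi (q ^ 2) =
        (\<Sum>\<alpha>\<in>?I. 1 powi \<alpha> * q powi (2 * \<alpha>^2)
           * ramanujan_f ((- 1) * q powi (m * (2 * m + 3 + 4 * \<alpha>))) ((- 1) * q powi (m * (2 * m + 1 - 4 * \<alpha>)))
           * ramanujan_f ((- 1) * q powi (3 * m + 2 - 4 * \<alpha>)) ((- 1) * q powi (m + 2 + 4 * \<alpha>)))"
  proof -
    have "ramanujan_phi (q ^ 2) = ramanujan_f (1 * q powi 2) (1 * q powi 2)"
      by (simp add: ramanujan_phi_def)
    thus ?thesis unfolding psi
      by (simp only:) (rule product, auto simp: power2_eq_square algebra_simps)
  qed
  \<comment> \<open>\<open>(A, B, C, D) = (m, 3 * m, 4, 0)\<close>.\<close>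
  have 8: "ramanujan_psi (- (q powi m)) * (2 * ramanujan_psi (q ^ 4)) =
        (\<Sum>\<alpha>\<in>?I. 1 powi \<alpha> * q powi (2 * \<alpha>^2 + 2 * \<alpha>)
           * ramanujan_f ((- 1) * q powi (m * (2 * m + 4 * \<alpha> + 5))) ((- 1) * q powi (m * (2 * m - 4 * \<alpha> - 1)))
           * ramanujan_f ((- 1) * q powi (3 * m - 4 * \<alpha>)) ((- 1) * q powi (m + 4 + 4 * \<alpha>)))"
    unfolding psi two_psi by (rule product) (auto simp: power2_eq_square algebra_simps)
  \<comment> \<open>The parity convention of \<open>ramanujan_f_par\<close> is exactly the sign
    found in the third identity.\<close>
  have par: "ramanujan_f_par (m + 1) x y
      = ramanujan_f ((- 1) powi (m + 1) * x) ((- 1) powi (m + 1) * y)" for x y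
    by (simp add: ramanujan_f_par_def power_int_minus_left)
  have two_mult: "2 * x * y = x * (2 * y)" for x y :: complex
    by simp
  have two_mult: "2 * x * y = x * (2 * y)" for x y :: complex
    by simp
  have two_mult: "2 * x * y = x * (2 * y)" for x y :: complex
    by simp
  show ?thesis
    unfolding par two_mult 3
    using 1 2 4 5 6 7 8 by simp
qed

end
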